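(* Consider a large-scale regime, that is, a sequence of two-block multilayer stochastic block models indexed by a scale parameter $\nu=1,2,\dots$, where the number of nodes $N=N_\nu$, the number of layers $T=T_\nu$, the intra-block link probabilities $p_1,\dots,p_T\in[0,1]$, and the inter-block link probabilities $q_1,\dots,q_T\in[0,1]$ may all depend on $\nu$. Let $I_T=\sum_{t=1}^T I(p_t,q_t)$. Assume that there is a constant $\delta>0$ not depending on $\nu$ such that $$I_T\ge(2+\delta)\frac{\log N}{N}.$$ For each $\nu$ let $z=z_\nu\in\mathcal{Z}$ be any particular block structure, and let $\Pi=\Pi_\nu$ be the uniform prior on the set $\mathcal{Z}=\mathcal{Z}_\nu$ of all block structures. Then the posterior distribution corresponding to $\Pi$ exactly recovers $z$, that is, $$\operatorname{Err}_z(0)=o(1)\qquad\text{as }\nu\to\infty .$$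
   Context: Notation: $[n]=\{1,\dots,n\}$; $\log$ is the natural logarithm. Model (for fixed $\nu$). There are $K=2$ blocks. The set of block structures is $\mathcal{Z}=\{z:[N]\to[2]\}$. The observation space $\mathfrak{X}$ is the set of all $X:[N]\times[N]\times[T]\to\{0,1\}$, with entries written $X^{(t)}_{ij}$, such that $X^{(t)}_{ij}=X^{(t)}_{ji}$ and $X^{(t)}_{ii}=0$ for all $i,j,t$. Given $z\in\mathcal{Z}$, the observation has the probability mass function $$P_z(X)=\prod_{1\le i<j\le N}\prod_{t=1}^T \mathrm{Ber}_{Q^{(t)}_{z(i)z(j)}}\big(X^{(t)}_{ij}\big),\qquad X\in\mathfrak{X},$$ where $\mathrm{Ber}_p(x)=(1-p)^{1-x}p^x$ for $x\in\{0,1\}$, and $Q^{(t)}_{ab}=p_t$ if $a=b$ and $Q^{(t)}_{ab}=q_t$ if $a\ne b$. Rényi divergence. $I(p,q)$ is the Rényi divergence of order $1/2$ between the Bernoulli distributions with means $p$ and $q$: $$I(p,q)=-2\log\Big((1-p)^{1/2}(1-q)^{1/2}+p^{1/2}q^{1/2}\Big).$$ Posterior. For a prior probability distribution $\Pi$ on $\mathcal{Z}$ and an observation $X\in\mathfrak{X}$, the posterior is $$\Pi_X(w)=\frac{\Pi(w)P_w(X)}{\sum_{w'\in\mathcal{Z}}\Pi(w')P_{w'}(X)},\qquad w\in\mathcal{Z}.$$ Error. The Hamming distance is $\operatorname{Ham}(w,z)=\#\{i\in[N]: w(i)\ne z(i)\}$. The absolute classification error is $d_{\mathrm{ACE}}(w,z)=\min\{\operatorname{Ham}(w,z),\operatorname{Ham}(w,\tilde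 z)\}$, where $\tilde z$ is obtained from $z$ by swapping the labels $1$ and $2$. For $r\ge 0$, $\operatorname{Err}_z(r)$ is the expected posterior mass of $\{w\in\mathcal{Z}: d_{\mathrm{ACE}}(w,z)>r\}$ when $X$ is sampled from $P_z$: $$\operatorname{Err}_z(r)=\sum_{X\in\mathfrak{X}}P_z(X)\,\Pi_X\big(\{w\in\mathcal{Z}: d_{\mathrm{ACE}}(w,z)>r\}\big).$$ In particular, $d_{\mathrm{ACE}}(w,z)=0$ if and only if $w\in\{z,\tilde z\}$.
   Formalization: The large-scale regime is taken to include that the number of nodes N_ν tends to infinity; with N fixed (e.g. N=2, T=1, constant p≠q in (0,1) with large enough I(p,q)) the error is a positive constant and the claim fails. *)

theory Defs
  imports "HOL-Probability.Probability" "HOL-Library.Landau_Symbols"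
begin

definition block_structures :: "nat \<Rightarrow> (nat \<Rightarrow> nat) set" where
  "block_structures N = {1..N} \<rightarrow>\<^sub>E {1..2}"

(* An observation X maps (i, j, t) to the entry of layer t for the node pair (i, j). *)
definition observations :: "nat \<Rightarrow> nat \<Rightarrow> (nat \<times> nat \<times> nat \<Rightarrow> nat) set" where
  "observations N T =
     {X \<in> ({1..N} \<times> {1..N} \<times> {1..T}) \<rightarrow>\<^sub>E {0, 1}.
        \<forall>t\<in>{1..T}. \<forall>i\<in>{1..N}. X (i, i, t) = 0 \<and> (\<forall>j\<in>{1..N}. X (i, j, t) = X (j, i, t))}"

(* Intended for x in {0, 1}, where the natural-number subtraction is exact. *)
definition bern :: "real \<Rightarrow> nat \<Rightarrow> real" where
  "bern p x = (1 - p) ^ (1 - x) * p ^ x"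

definition link_prob :: "(nat \<Rightarrow> real) \<Rightarrow> (nat \<Rightarrow> real) \<Rightarrow> nat \<Rightarrow> nat \<Rightarrow> nat \<Rightarrow> real" where
  "link_prob p q t a b = (if a = b then p t else q t)"

definition likelihood ::
  "nat \<Rightarrow> nat \<Rightarrow> (nat \<Rightarrow> real) \<Rightarrow> (nat \<Rightarrow> real) \<Rightarrow> (nat \<Rightarrow> nat) \<Rightarrow> (nat \<times> nat \<times> nat \<Rightarrow> nat) \<Rightarrow> real" where
  "likelihood N T p q z X =
     (\<Prod>(i, j)\<in>{(i, j). 1 \<le> i \<and> i < j \<and> j \<le> N}.
        \<Prod>t=1..T. bern (link_prob p q t (z i) (z j)) (X (i, j, t)))"

(* The affinity vanishes exactly for the mutually singular pairs {p, q} = {0, 1}, where the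
   divergence is infinite; ln 0 = 0 on the reals would give the value 0 there. *)
definition renyi_half :: "real \<Rightarrow> real \<Rightarrow> ereal" where
  "renyi_half p q =
     (let s = sqrt (1 - p) * sqrt (1 - q) + sqrt p * sqrt q
      in if s = 0 then \<infinity> else ereal (- 2 * ln s))"

(* Observations of marginal probability 0 get the value 0 (x / 0 = 0); they carry no mass
   under the likelihood of any w in the support of the prior. *)
definition posterior ::
  "nat \<Rightarrow> nat \<Rightarrow> (nat \<Rightarrow> real) \<Rightarrow> (nat \<Rightarrow> real) \<Rightarrow> (nat \<Rightarrow> nat) pmf
     \<Rightarrow> (nat \<times> nat \<times> nat \<Rightarrow> nat) \<Rightarrow> (nat \<Rightarrow> nat) \<Rightarrow> real" where
  "posterior N T p q prior X w =
     pmf prior w * likelihood N T p q w X /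
       (\<Sum>w'\<in>block_structures N. pmf prior w' * likelihood N T p q w' X)"

definition hamming :: "nat \<Rightarrow> (nat \<Rightarrow> nat) \<Rightarrow> (nat \<Rightarrow> nat) \<Rightarrow> nat" where
  "hamming N w z = card {i \<in> {1..N}. w i \<noteq> z i}"

definition swap_labels :: "nat \<Rightarrow> (nat \<Rightarrow> nat) \<Rightarrow> (nat \<Rightarrow> nat)" where
  "swap_labels N z = (\<lambda>i\<in>{1..N}. if z i = 1 then 2 else 1)"

definition d_ACE :: "nat \<Rightarrow> (nat \<Rightarrow> nat) \<Rightarrow> (nat \<Rightarrow> nat) \<Rightarrow> nat" where
  "d_ACE N w z = min (hamming N w z) (hamming N w (swap_labels N z))"

definition posterior_error ::
  "nat \<Rightarrow> nat \<Rightarrow> (nat \<Rightarrow> real) \<Rightarrow> (nat \<Rightarrow> real) \<Rightarrow> (nat \<Rightarrow> nat) pmf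
     \<Rightarrow> (nat \<Rightarrow> nat) \<Rightarrow> real \<Rightarrow> real" where
  "posterior_error N T p q prior z r =
     (\<Sum>X\<in>observations N T. likelihood N T p q z X *
        (\<Sum>w\<in>{w \<in> block_structures N. real (d_ACE N w z) > r}. posterior N T p q prior X w))"

end

theory Submission
  imports Defs
begin

text \<open>
  Let \<open>P\<^sub>w\<close> be the likelihood of \<open>w\<close>. Under the uniform prior the posterior of \<open>w\<close> is
  \<open>P\<^sub>w / S\<close> with \<open>S = \<Sum>w'. P\<^sub>w'\<close>. Since \<open>S\<close> dominates both \<open>P\<^sub>z\<close> and \<open>P\<^sub>w\<close>, it dominates their
  geometric mean, so \<open>P\<^sub>z P\<^sub>w / S \<le> \<surd>(P\<^sub>z P\<^sub>w)\<close>: the expected posterior mass of \<open>w\<close> is at most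
  the Bhattacharyya coefficient of \<open>P\<^sub>z\<close> and \<open>P\<^sub>w\<close>.

  This coefficient is a product over node pairs and layers. A factor is 1 unless the pair
  is joined within a block by exactly one of \<open>z\<close> and \<open>w\<close>. With two blocks such pairs are the ones
  cut by the set \<open>D\<close> of nodes where \<open>w\<close> and \<open>z\<close> differ, so if \<open>D\<close> has \<open>k\<close> elements, there are
  \<open>k (N - k)\<close> of them. Each contributes \<open>\<rho> = exp (- I / 2)\<close> over all layers, where \<open>I\<close> is the sum
  of the Renyi divergences (\<open>sum_sqrt_likelihood_le_power\<close>). The structure \<open>w\<close> is wrong exactly
  when \<open>0 < k < N\<close>, and it is determined by \<open>D\<close>, whence the error is at most
  \<open>\<Sum>k=1..<N. (N choose k) \<rho>^(k (N - k))\<close> (\<open>posterior_error_le_binomial_sum\<close>).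

  With \<open>e = \<delta> / 2\<close> the hypothesis says \<open>\<rho> \<le> N powr (- (1 + e) / N)\<close>. For \<open>k = 1\<close> the summand is about
  \<open>N powr (- e)\<close>, which tends to 0 only because the constant in the hypothesis exceeds 2. By the symmetry between \<open>k\<close> and
  \<open>N - k\<close> only \<open>j = min k (N - k)\<close> matters. If \<open>j\<close> is below a small multiple of \<open>N\<close>, then
  \<open>N choose j \<le> N^j\<close> gives geometrically decaying terms; if it is above, the power of \<open>\<rho>\<close> is at most
  \<open>N powr (- e N / 4)\<close>, which beats the sum \<open>2^N\<close> of all binomial coefficients
  (\<open>binomial_term_le_half\<close>, \<open>binomial_sum_le\<close>).
\<close>

section \<open>The Bhattacharyya affinity of two block structures\<close>

text \<open>The Bhattacharyya coefficient of two Bernoulli distributions, so that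
  \<open>renyi_half a b = - 2 ln (affinity a b)\<close> whenever the affinity is nonzero.\<close>
definition affinity :: "real \<Rightarrow> real \<Rightarrow> real" where
  "affinity a b = sqrt (1 - a) * sqrt (1 - b) + sqrt a * sqrt b"

lemma affinity_commute: "affinity a b = affinity b a"
  by (simp add: affinity_def mult.commute)

lemma affinity_self: "a \<in> {0..1} \<Longrightarrow> affinity a a = 1"
  by (simp add: affinity_def)

lemma affinity_nonneg: "a \<in> {0..1} \<Longrightarrow> b \<in> {0..1} \<Longrightarrow> 0 \<le> affinity a b"
  by (simp add: affinity_def)

lemma affinity_eq_sum_bern: "affinity a b = (\<Sum>x\<in>{0,1}. sqrt (bern a x) * sqrt (bern b x))"
  by (simp add: affinity_def bern_def)

lemma bern_nonneg: "a \<in> {0..1} \<Longrightarrow> 0 \<le> bern a x"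
  by (simp add: bern_def)

lemma link_prob_in_unit:
  assumes "p t \<in> {0..1}" "q t \<in> {0..1}"
  shows "link_prob p q t a b \<in> {0..1}"
  using assms by (simp add: link_prob_def)

definition node_pairs :: "nat \<Rightarrow> (nat \<times> nat) set" where
  "node_pairs N = {(i, j). 1 \<le> i \<and> i < j \<and> j \<le> N}"

lemma finite_node_pairs [simp]: "finite (node_pairs N)"
  by (rule finite_subset[of _ "{1..N} \<times> {1..N}"]) (auto simp: node_pairs_def)

lemma likelihood_eq:
  "likelihood N T p q z X =
     (\<Prod>((i, j), t)\<in>node_pairs N \<times> {1..T}. bern (link_prob p q t (z i) (z j)) (X (i, j, t)))"
  unfolding likelihood_def node_pairs_def[symmetric]
  by (simp add: prod.cartesian_product case_prod_unfold)

lemma likelihood_nonneg: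
  assumes "\<And>t. t \<in> {1..T} \<Longrightarrow> p t \<in> {0..1}" "\<And>t. t \<in> {1..T} \<Longrightarrow> q t \<in> {0..1}"
  shows "0 \<le> likelihood N T p q z X"
  unfolding likelihood_eq
  by (intro prod_nonneg) (auto intro!: bern_nonneg link_prob_in_unit simp del: atLeastAtMost_iff
      simp: assms)

lemma sqrt_prod: "sqrt (\<Prod>x\<in>A. f x) = (\<Prod>x\<in>A. sqrt (f x))"
  by (induction A rule: infinite_finite_induct) (simp_all add: real_sqrt_mult)

lemma finite_observations [simp]: "finite (observations N T)"
  unfolding observations_def
  by (rule finite_subset[of _ "({1..N} \<times> {1..N} \<times> {1..T}) \<rightarrow>\<^sub>E {0, 1::nat}"])
    (auto intro!: finite_PiE)

text \<open>Symmetric observations are determined by their entries above the diagonal. Summing over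
  these free entries instead turns a sum of products into a product of sums.\<close>
definition upper_entries ::
  "nat \<Rightarrow> nat \<Rightarrow> (nat \<times> nat \<times> nat \<Rightarrow> nat) \<Rightarrow> ((nat \<times> nat) \<times> nat \<Rightarrow> nat)" where
  "upper_entries N T X = (\<lambda>((i, j), t)\<in>node_pairs N \<times> {1..T}. X (i, j, t))"

lemma upper_entries_in:
  assumes "X \<in> observations N T"
  shows "upper_entries N T X \<in> (node_pairs N \<times> {1..T}) \<rightarrow>\<^sub>E {0, 1}"
proof (rule PiE_I)
  fix e assume e: "e \<in> node_pairs N \<times> {1..T}"
  obtain i j t where [simp]: "e = ((i, j), t)" by (cases e) auto
  have "(i, j, t) \<in> {1..N} \<times> {1..N} \<times> {1..T}" using e by (auto simp: node_pairs_def)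
  moreover have "X \<in> ({1..N} \<times> {1..N} \<times> {1..T}) \<rightarrow>\<^sub>E {0, 1}"
    using assms by (simp add: observations_def)
  ultimately have "X (i, j, t) \<in> {0, 1}" by (rule PiE_mem[rotated])
  then show "upper_entries N T X e \<in> {0, 1}" using e by (simp add: upper_entries_def)
qed (simp add: upper_entries_def)

lemma inj_on_upper_entries: "inj_on (upper_entries N T) (observations N T)"
proof (rule inj_onI)
  fix X Y assume X: "X \<in> observations N T" and Y: "Y \<in> observations N T"
    and eq: "upper_entries N T X = upper_entries N T Y"
  have upper: "X (i, j, t) = Y (i, j, t)" if "1 \<le> i" "i < j" "j \<le> N" "t \<in> {1..T}" for i j t
    using fun_cong[OF eq, of "((i, j), t)"] that by (simp add: upper_entries_def node_pairs_def)
  show "X = Y"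
  proof (rule PiE_ext)
    show "X \<in> ({1..N} \<times> {1..N} \<times> {1..T}) \<rightarrow>\<^sub>E {0, 1}"
      and "Y \<in> ({1..N} \<times> {1..N} \<times> {1..T}) \<rightarrow>\<^sub>E {0, 1}"
      using X Y by (simp_all add: observations_def)
    fix e assume "e \<in> {1..N} \<times> {1..N} \<times> {1..T}"
    then obtain i j t where e: "e = (i, j, t)" and i: "i \<in> {1..N}" and j: "j \<in> {1..N}"
      and t: "t \<in> {1..T}" by auto
    have sym: "X (i, j, t) = X (j, i, t)" "Y (i, j, t) = Y (j, i, t)"
      and diag: "X (i, i, t) = 0" "Y (i, i, t) = 0"
      using X Y i j t unfolding observations_def by blast+
    consider "i < j" | "j < i" | "i = j" by linarith
    then show "X e = Y e"
    proof cases
      case 1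
      then show ?thesis using upper[of i j t] i j t e by simp
    next
      case 2
      then show ?thesis using upper[of j i t] i j t e sym by simp
    next
      case 3
      then show ?thesis using diag e by simp
    qed
  qed
qed

text \<open>Tensorization: the entries above the diagonal are independent under both likelihoods, so the
  Bhattacharyya coefficient factorizes.\<close>
lemma sum_sqrt_likelihood_le:
  assumes p: "\<And>t. t \<in> {1..T} \<Longrightarrow> p t \<in> {0..1}" and q: "\<And>t. t \<in> {1..T} \<Longrightarrow> q t \<in> {0..1}"
  shows "(\<Sum>X\<in>observations N T. sqrt (likelihood N T p q z X) * sqrt (likelihood N T p q w X))
    \<le> (\<Prod>((i, j), t)\<in>node_pairs N \<times> {1..T}.
         affinity (link_prob p q t (z i) (z j)) (link_prob p q t (w i) (w j)))"
proof -
  let ?E = "node_pairs N \<times> {1..T}"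
  define f where "f v e x =
    sqrt (bern (link_prob p q (snd e) (v (fst (fst e))) (v (snd (fst e)))) x)" for v :: "nat \<Rightarrow> nat" and e and x :: nat
  have f_nonneg: "0 \<le> f v e x" if "e \<in> ?E" for v e x
    unfolding f_def using that p q
    by (intro real_sqrt_ge_zero bern_nonneg link_prob_in_unit) (auto simp del: atLeastAtMost_iff)
  have sqrt_lik: "sqrt (likelihood N T p q v X) = (\<Prod>e\<in>?E. f v e (upper_entries N T X e))" for v X
    unfolding likelihood_eq sqrt_prod
    by (intro prod.cong) (auto simp: f_def upper_entries_def)
  have "(\<Sum>X\<in>observations N T. sqrt (likelihood N T p q z X) * sqrt (likelihood N T p q w X))
      = (\<Sum>X\<in>observations N T.
          \<Prod>e\<in>?E. f z e (upper_entries N T X e) * f w e (upper_entries N T X e))"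
    by (simp add: sqrt_lik prod.distrib)
  also have "\<dots> = (\<Sum>g\<in>upper_entries N T ` observations N T. \<Prod>e\<in>?E. f z e (g e) * f w e (g e))"
    by (simp add: sum.reindex[OF inj_on_upper_entries])
  also have "\<dots> \<le> (\<Sum>g\<in>?E \<rightarrow>\<^sub>E {0, 1}. \<Prod>e\<in>?E. f z e (g e) * f w e (g e))"
  proof (rule sum_mono2)
    show "finite (?E \<rightarrow>\<^sub>E {0, 1::nat})" by (intro finite_PiE) auto
    show "upper_entries N T ` observations N T \<subseteq> ?E \<rightarrow>\<^sub>E {0, 1}"
      by (intro image_subsetI upper_entries_in)
  qed (intro prod_nonneg mult_nonneg_nonneg f_nonneg)
  also have "\<dots> = (\<Prod>e\<in>?E. \<Sum>x\<in>{0, 1}. f z e x * f w e x)"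
    by (rule prod_sum_PiE[symmetric]) auto
  also have "\<dots> = (\<Prod>((i, j), t)\<in>?E.
      affinity (link_prob p q t (z i) (z j)) (link_prob p q t (w i) (w j)))"
    by (intro prod.cong) (auto simp: f_def affinity_eq_sum_bern)
  finally show ?thesis .
qed

lemma card_cut_pairs:
  assumes "D \<subseteq> {1..N}"
  shows "card {(i, j) \<in> node_pairs N. (i \<in> D) \<noteq> (j \<in> D)} = card D * (N - card D)"
proof -
  let ?f = "\<lambda>(a, b). (min a b, max a b :: nat)"
  let ?S = "{(i, j) \<in> node_pairs N. (i \<in> D) \<noteq> (j \<in> D)}"
  have "bij_betw ?f (D \<times> ({1..N} - D)) ?S"
  proof (rule bij_betw_imageI)
    show "inj_on ?f (D \<times> ({1..N} - D))"
      by (auto simp: inj_on_def min_def max_def split: if_splits)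
    show "?f ` (D \<times> ({1..N} - D)) = ?S"
    proof (intro equalityI subsetI)
      fix e assume "e \<in> ?f ` (D \<times> ({1..N} - D))"
      then obtain a b where ab: "a \<in> D" "b \<in> {1..N}" "b \<notin> D" and e: "e = (min a b, max a b)"
        by auto
      have "a \<in> {1..N}" "a \<noteq> b" using ab assms by auto
      then show "e \<in> ?S"
        using ab unfolding e by (cases "a \<le> b") (auto simp: node_pairs_def min_def max_def)
    next
      fix e assume "e \<in> ?S"
      then obtain i j where e: "e = (i, j)" and ij: "1 \<le> i" "i < j" "j \<le> N" "(i \<in> D) \<noteq> (j \<in> D)"
        by (auto simp: node_pairs_def)
      show "e \<in> ?f ` (D \<times> ({1..N} - D))"
      proof (cases "i \<in> D")
        case True
        then show ?thesis using ij e by (intro image_eqI[of _ _ "(i, j)"]) auto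
      next
        case False
        then show ?thesis using ij e by (intro image_eqI[of _ _ "(j, i)"]) auto
      qed
    qed
  qed
  then have "card ?S = card (D \<times> ({1..N} - D))" by (rule bij_betw_same_card[symmetric])
  also have "\<dots> = card D * (N - card D)"
    using assms by (simp add: card_cartesian_product card_Diff_subset finite_subset)
  finally show ?thesis .
qed

definition differing_nodes :: "nat \<Rightarrow> (nat \<Rightarrow> nat) \<Rightarrow> (nat \<Rightarrow> nat) \<Rightarrow> nat set" where
  "differing_nodes N w z = {i \<in> {1..N}. w i \<noteq> z i}"

lemma hamming_eq_card: "hamming N w z = card (differing_nodes N w z)"
  by (simp add: hamming_def differing_nodes_def)

lemma block_structures_label:
  assumes "z \<in> block_structures N" "i \<in> {1..N}"
  shows "z i = 1 \<or> z i = 2"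
proof -
  have "z i \<in> {1..2}" using assms unfolding block_structures_def by (rule PiE_mem)
  then show ?thesis by auto
qed

text \<open>With only two labels, flipping the label of exactly one endpoint of a pair changes whether the
  endpoints share a block, and flipping both or neither does not. So the factors different from
  1 belong to the pairs cut by \<open>differing_nodes N w z\<close>, and each of these compares \<open>p\<close> with \<open>q\<close> in
  every layer.\<close>
lemma sum_sqrt_likelihood_le_power:
  assumes p: "\<And>t. t \<in> {1..T} \<Longrightarrow> p t \<in> {0..1}" and q: "\<And>t. t \<in> {1..T} \<Longrightarrow> q t \<in> {0..1}"
    and z: "z \<in> block_structures N" and w: "w \<in> block_structures N"
  shows "(\<Sum>X\<in>observations N T. sqrt (likelihood N T p q z X) * sqrt (likelihood N T p q w X))
    \<le> (\<Prod>t=1..T. affinity (p t) (q t)) ^ (hamming N w z * (N - hamming N w z))"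
proof -
  let ?D = "differing_nodes N w z"
  let ?\<rho> = "\<Prod>t=1..T. affinity (p t) (q t)"
  let ?a = "\<lambda>i j t. affinity (link_prob p q t (z i) (z j)) (link_prob p q t (w i) (w j))"
  have pair: "(\<Prod>t=1..T. ?a i j t) = (if (i \<in> ?D) \<noteq> (j \<in> ?D) then ?\<rho> else 1)"
    if "(i, j) \<in> node_pairs N" for i j
  proof -
    have i: "i \<in> {1..N}" and j: "j \<in> {1..N}" using that by (auto simp: node_pairs_def)
    have lab: "z i = 1 \<or> z i = 2" "z j = 1 \<or> z j = 2" "w i = 1 \<or> w i = 2" "w j = 1 \<or> w j = 2"
      using block_structures_label z w i j by auto
    have iff: "((i \<in> ?D) \<noteq> (j \<in> ?D)) \<longleftrightarrow> ((z i = z j) \<noteq> (w i = w j))"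
      using lab i j unfolding differing_nodes_def by auto
    have "?a i j t = (if (i \<in> ?D) \<noteq> (j \<in> ?D) then affinity (p t) (q t) else 1)"
      if "t \<in> {1..T}" for t
      unfolding iff using p[OF that] q[OF that]
      by (auto simp: link_prob_def affinity_self affinity_commute simp del: atLeastAtMost_iff)
    then show ?thesis by simp
  qed
  have "(\<Sum>X\<in>observations N T. sqrt (likelihood N T p q z X) * sqrt (likelihood N T p q w X))
      \<le> (\<Prod>((i, j), t)\<in>node_pairs N \<times> {1..T}. ?a i j t)"
    by (rule sum_sqrt_likelihood_le[OF p q])
  also have "\<dots> = (\<Prod>(i, j)\<in>node_pairs N. \<Prod>t=1..T. ?a i j t)"
    by (simp add: prod.cartesian_product case_prod_unfold)
  also have "\<dots> = (\<Prod>(i, j)\<in>node_pairs N. if (i \<in> ?D) \<noteq> (j \<in> ?D) then ?\<rho> else 1)"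
    using pair by (intro prod.cong) auto
  also have "\<dots> = ?\<rho> ^ card {(i, j) \<in> node_pairs N. (i \<in> ?D) \<noteq> (j \<in> ?D)}"
    by (simp add: case_prod_unfold prod.inter_filter[symmetric])
  also have "card {(i, j) \<in> node_pairs N. (i \<in> ?D) \<noteq> (j \<in> ?D)} = card ?D * (N - card ?D)"
    by (rule card_cut_pairs) (auto simp: differing_nodes_def)
  finally show ?thesis by (simp add: hamming_eq_card)
qed

section \<open>From the posterior error to a binomial sum\<close>

lemma finite_block_structures [simp]: "finite (block_structures N)"
  unfolding block_structures_def by (intro finite_PiE) auto

text \<open>A common upper bound \<open>s\<close> of \<open>a\<close> and \<open>b\<close> is at least their geometric mean. The form of the left
  side is that of a likelihood times a posterior.\<close>
lemma mult_divide_le_sqrt: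
  fixes a b s :: real
  assumes "0 \<le> a" "0 \<le> b" "a \<le> s" "b \<le> s"
  shows "a * (b / s) \<le> sqrt a * sqrt b"
proof (cases "s = 0")
  case False
  then have s: "s > 0" using assms by linarith
  have "sqrt a * sqrt b \<le> sqrt s * sqrt s"
    using assms by (intro mult_mono) auto
  then have "sqrt a * sqrt b \<le> s" using s by simp
  then have "(sqrt a * sqrt b) * (sqrt a * sqrt b) \<le> (sqrt a * sqrt b) * s"
    using assms by (intro mult_left_mono) auto
  moreover have "(sqrt a * sqrt b) * (sqrt a * sqrt b) = a * b"
    using assms by (simp add: algebra_simps)
  ultimately show ?thesis using s by (simp add: field_simps)
qed (use assms in auto)

lemma posterior_uniform:
  assumes "block_structures N \<noteq> {}" and "w \<in> block_structures N"
  shows "posterior N T p q (pmf_of_set (block_structures N)) X w =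
    likelihood N T p q w X / (\<Sum>w'\<in>block_structures N. likelihood N T p q w' X)"
proof -
  let ?c = "1 / real (card (block_structures N))"
  have "?c \<noteq> 0" using assms by simp
  have "(\<Sum>w'\<in>block_structures N. pmf (pmf_of_set (block_structures N)) w' * likelihood N T p q w' X)
      = ?c * (\<Sum>w'\<in>block_structures N. likelihood N T p q w' X)"
    unfolding sum_distrib_left using assms by (intro sum.cong) auto
  moreover have "pmf (pmf_of_set (block_structures N)) w = ?c" using assms by simp
  ultimately show ?thesis unfolding posterior_def
    using \<open>?c \<noteq> 0\<close> by (simp only: mult_divide_mult_cancel_left not_False_eq_True)
qed

text \<open>With two labels, disagreeing with \<open>z\<close> at every node means agreeing with the swapped \<open>z\<close>
  everywhere; a wrong structure must therefore agree with \<open>z\<close> at some node.\<close>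
lemma hamming_of_d_ACE_pos:
  assumes z: "z \<in> block_structures N" and w: "w \<in> block_structures N" and d: "0 < d_ACE N w z"
  shows "0 < hamming N w z" "hamming N w z < N"
proof -
  show "0 < hamming N w z" using d by (simp add: d_ACE_def)
  have "{i \<in> {1..N}. w i \<noteq> swap_labels N z i} \<noteq> {}"
    using d by (auto simp: d_ACE_def hamming_def card_gt_0_iff)
  then obtain i where i: "i \<in> {1..N}" and ne: "w i \<noteq> swap_labels N z i" by auto
  have "w i = z i"
    using ne i block_structures_label[OF z i] block_structures_label[OF w i]
    by (auto simp: swap_labels_def split: if_splits)
  then have "i \<notin> differing_nodes N w z" by (simp add: differing_nodes_def)
  moreover have "differing_nodes N w z \<subseteq> {1..N}" by (auto simp: differing_nodes_def)
  ultimately have "differing_nodes N w z \<subset> {1..N}" using i by blast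
  then have "card (differing_nodes N w z) < card {1..N}" by (intro psubset_card_mono) auto
  then show "hamming N w z < N" by (simp add: hamming_eq_card)
qed

text \<open>Where \<open>w\<close> differs from \<open>z\<close>, it takes the only other label. Hence there are at most
  \<open>N choose k\<close> structures at Hamming distance \<open>k\<close> from \<open>z\<close>.\<close>
lemma inj_on_differing_nodes:
  assumes z: "z \<in> block_structures N"
  shows "inj_on (\<lambda>w. differing_nodes N w z) (block_structures N)"
proof (rule inj_onI)
  fix v w assume v: "v \<in> block_structures N" and w: "w \<in> block_structures N"
    and eq: "differing_nodes N v z = differing_nodes N w z"
  show "v = w"
  proof (rule PiE_ext)
    show "v \<in> {1..N} \<rightarrow>\<^sub>E {1..2}" "w \<in> {1..N} \<rightarrow>\<^sub>E {1..2}"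
      using v w by (simp_all add: block_structures_def)
    fix i assume i: "i \<in> {1..N}"
    have "v i \<noteq> z i \<longleftrightarrow> w i \<noteq> z i" using eq i by (auto simp: differing_nodes_def)
    then show "v i = w i"
      using block_structures_label[OF v i] block_structures_label[OF w i]
        block_structures_label[OF z i] by auto
  qed
qed

lemma sum_over_subsets_by_card:
  fixes f :: "nat \<Rightarrow> real"
  assumes "finite A" "finite K"
  shows "(\<Sum>D\<in>{D. D \<subseteq> A \<and> card D \<in> K}. f (card D)) = (\<Sum>k\<in>K. real (card A choose k) * f k)"
proof -
  let ?S = "{D. D \<subseteq> A \<and> card D \<in> K}"
  have fin: "finite ?S" using assms by simp
  have "(\<Sum>D\<in>?S. f (card D)) = (\<Sum>k\<in>K. \<Sum>D\<in>{D\<in>?S. card D = k}. f (card D))"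
    by (rule sum.group[symmetric]) (use fin assms in auto)
  also have "\<dots> = (\<Sum>k\<in>K. real (card A choose k) * f k)"
  proof (rule sum.cong)
    fix k assume "k \<in> K"
    then have "{D\<in>?S. card D = k} = {D. D \<subseteq> A \<and> card D = k}" by auto
    then show "(\<Sum>D\<in>{D\<in>?S. card D = k}. f (card D)) = real (card A choose k) * f k"
      using n_subsets[OF assms(1), of k] by simp
  qed simp
  finally show ?thesis .
qed

lemma posterior_error_le_binomial_sum:
  assumes p: "\<And>t. t \<in> {1..T} \<Longrightarrow> p t \<in> {0..1}" and q: "\<And>t. t \<in> {1..T} \<Longrightarrow> q t \<in> {0..1}"
    and z: "z \<in> block_structures N"
  shows "posterior_error N T p q (pmf_of_set (block_structures N)) z 0
    \<le> (\<Sum>k=1..<N. real (N choose k) * (\<Prod>t=1..T. affinity (p t) (q t)) ^ (k * (N - k)))"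
proof -
  let ?L = "\<lambda>w X. likelihood N T p q w X"
  let ?\<rho> = "\<Prod>t=1..T. affinity (p t) (q t)"
  let ?W = "{w \<in> block_structures N. real (d_ACE N w z) > 0}"
  let ?S = "{D. D \<subseteq> {1..N} \<and> card D \<in> {1..<N}}"
  have nn: "0 \<le> ?L w X" for w X by (rule likelihood_nonneg[OF p q])
  have \<rho>: "0 \<le> ?\<rho>" by (intro prod_nonneg affinity_nonneg p q)
  have term_le: "?L z X * posterior N T p q (pmf_of_set (block_structures N)) X w
      \<le> sqrt (?L z X) * sqrt (?L w X)" if "w \<in> block_structures N" for w X
  proof -
    have "posterior N T p q (pmf_of_set (block_structures N)) X w =
        ?L w X / (\<Sum>w'\<in>block_structures N. ?L w' X)"
      using that by (intro posterior_uniform) auto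
    moreover have "?L v X \<le> (\<Sum>w'\<in>block_structures N. ?L w' X)" if "v \<in> block_structures N" for v
      using that nn by (intro member_le_sum) auto
    ultimately show ?thesis using mult_divide_le_sqrt[OF nn nn] that z by presburger
  qed
  have "posterior_error N T p q (pmf_of_set (block_structures N)) z 0
      = (\<Sum>w\<in>?W. \<Sum>X\<in>observations N T.
          ?L z X * posterior N T p q (pmf_of_set (block_structures N)) X w)"
    unfolding posterior_error_def sum_distrib_left by (rule sum.swap)
  also have "\<dots> \<le> (\<Sum>w\<in>?W. \<Sum>X\<in>observations N T. sqrt (?L z X) * sqrt (?L w X))"
    using term_le by (intro sum_mono) auto
  also have "\<dots> \<le> (\<Sum>w\<in>?W. ?\<rho> ^ (hamming N w z * (N - hamming N w z)))"
    using sum_sqrt_likelihood_le_power[OF p q z] by (intro sum_mono) auto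
  also have "\<dots> = (\<Sum>D\<in>(\<lambda>w. differing_nodes N w z) ` ?W. ?\<rho> ^ (card D * (N - card D)))"
    by (subst sum.reindex[OF inj_on_subset[OF inj_on_differing_nodes[OF z]]])
      (auto simp: hamming_eq_card)
  also have "\<dots> \<le> (\<Sum>D\<in>?S. ?\<rho> ^ (card D * (N - card D)))"
  proof (rule sum_mono2)
    show "(\<lambda>w. differing_nodes N w z) ` ?W \<subseteq> ?S"
    proof clarify
      fix w assume w: "w \<in> block_structures N" "0 < real (d_ACE N w z)"
      then have "0 < hamming N w z" "hamming N w z < N"
        using hamming_of_d_ACE_pos[OF z] by auto
      then show "differing_nodes N w z \<subseteq> {1..N} \<and> card (differing_nodes N w z) \<in> {1..<N}"
        by (auto simp: hamming_eq_card differing_nodes_def)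
    qed
  qed (use \<rho> in auto)
  also have "\<dots> = (\<Sum>k=1..<N. real (N choose k) * ?\<rho> ^ (k * (N - k)))"
    using sum_over_subsets_by_card[of "{1..N}" "{1..<N}" "\<lambda>k. ?\<rho> ^ (k * (N - k))"] by simp
  finally show ?thesis .
qed

section \<open>Asymptotics of the binomial sum\<close>

text \<open>Exponentiates the divergence bound. A layer with mutually singular link laws has infinite
  divergence and affinity 0, which makes the product vanish.\<close>
lemma prod_affinity_le_exp:
  fixes p q :: "nat \<Rightarrow> real"
  assumes p: "\<And>t. t \<in> {1..T} \<Longrightarrow> p t \<in> {0..1}" and q: "\<And>t. t \<in> {1..T} \<Longrightarrow> q t \<in> {0..1}"
    and I: "(\<Sum>t=1..T. renyi_half (p t) (q t)) \<ge> ereal c"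
  shows "(\<Prod>t=1..T. affinity (p t) (q t)) \<le> exp (- c / 2)"
proof (cases "\<exists>t\<in>{1..T}. affinity (p t) (q t) = 0")
  case True
  then have "(\<Prod>t=1..T. affinity (p t) (q t)) = 0" by (intro prod_zero finite_atLeastAtMost)
  then show ?thesis by (simp only: exp_ge_zero)
next
  case False
  then have pos: "affinity (p t) (q t) > 0" if "t \<in> {1..T}" for t
    using affinity_nonneg[OF p[OF that] q[OF that]] that by force
  have "(\<Sum>t=1..T. renyi_half (p t) (q t)) = (\<Sum>t=1..T. ereal (- 2 * ln (affinity (p t) (q t))))"
    using False by (intro sum.cong) (auto simp: renyi_half_def affinity_def Let_def)
  also have "\<dots> = ereal (\<Sum>t=1..T. - 2 * ln (affinity (p t) (q t)))" by (rule sum_ereal)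
  also have "\<dots> = ereal (- 2 * (\<Sum>t=1..T. ln (affinity (p t) (q t))))"
    by (simp only: sum_distrib_left)
  finally have "(\<Sum>t=1..T. ln (affinity (p t) (q t))) \<le> - c / 2" using I by simp
  moreover have "(\<Prod>t=1..T. affinity (p t) (q t)) = exp (\<Sum>t=1..T. ln (affinity (p t) (q t)))"
    using pos by (simp add: exp_sum)
  ultimately show ?thesis by simp
qed

text \<open>The exponent of \<open>1 / N\<close> in the bound on \<open>\<rho> ^ (j * (N - j))\<close> is
  \<open>m = (1 + e) j (N - j) / N\<close>. The loss against \<open>(1 + e) j\<close> is \<open>(1 + e) j\<^sup>2 / N\<close>, which is at most
  \<open>(e / 2) j\<close> exactly when \<open>(1 + e) j \<le> (e / 2) N\<close>. In that range \<open>m \<ge> (1 + e / 2) j\<close> outweighs the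
  binomial coefficient by a factor \<open>N powr (- e / 2)\<close> for each of the \<open>j\<close> nodes; beyond it
  \<open>N - j \<ge> N / 2\<close> gives \<open>m \<ge> (e / 4) N\<close>.\<close>
lemma binomial_term_le_half:
  fixes \<rho> e :: real
  assumes "1 \<le> j" "2 * j \<le> N" and e: "e > 0" and \<rho>0: "0 \<le> \<rho>"
    and \<rho>: "\<rho> \<le> exp (- (1 + e) * ln (real N) / real N)"
  shows "real (N choose j) * \<rho> ^ (j * (N - j))
    \<le> (real N powr (- e / 2)) ^ j + real (N choose j) * (real N powr (- e / 4)) ^ N"
proof -
  have N: "N \<ge> 2" using assms by linarith
  let ?l = "ln (real N)"
  have l: "?l > 0" using N by simp
  have powr_pow: "(real N powr a) ^ n = exp (real n * a * ?l)" for a n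
    using N by (simp add: powr_def exp_of_nat_mult[symmetric] algebra_simps)
  define m where "m = (1 + e) * (real j * real (N - j) / real N)"
  have "\<rho> ^ (j * (N - j)) \<le> exp (- (1 + e) * ?l / real N) ^ (j * (N - j))"
    using \<rho>0 \<rho> by (rule power_mono[rotated])
  also have "\<dots> = exp (- m * ?l)"
    unfolding m_def exp_of_nat_mult[symmetric] mult_minus_left minus_divide_left[symmetric]
    by (simp add: mult_ac del: minus_add_distrib)
  finally have bound: "\<rho> ^ (j * (N - j)) \<le> exp (- m * ?l)" .
  have Nj: "real (N - j) = real N - real j" using assms by simp
  show ?thesis
  proof (cases "(1 + e) * real j \<le> e / 2 * real N")
    case True
    have "real j * (real N - real j) * (1 + e) - (1 + e / 2) * real j * real N
        = real j * (e / 2 * real N - (1 + e) * real j)" by (simp add: field_simps)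
    also have "\<dots> \<ge> 0" using True by simp
    finally have "m \<ge> (1 + e / 2) * real j"
      using N by (simp add: m_def Nj field_simps)
    then have "- m * ?l \<le> - ((1 + e / 2) * real j) * ?l" using l by (intro mult_right_mono) auto
    have "real (N choose j) \<le> real N ^ j"
      using binomial_le_pow[of j N] assms by (simp flip: of_nat_power)
    also have "\<dots> = exp (real j * ?l)" using N by (simp add: exp_of_nat_mult)
    finally have "real (N choose j) * \<rho> ^ (j * (N - j)) \<le> exp (real j * ?l) * exp (- m * ?l)"
      using bound \<rho>0 by (intro mult_mono) auto
    also have "\<dots> = exp (real j * ?l + - m * ?l)" by (rule exp_add[symmetric])
    also have "\<dots> \<le> exp (real j * ?l + - ((1 + e / 2) * real j) * ?l)"
      using \<open>- m * ?l \<le> _\<close> by simp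
    also have "\<dots> = (real N powr (- e / 2)) ^ j" unfolding powr_pow by (simp add: algebra_simps)
    finally show ?thesis by (smt (verit) mult_nonneg_nonneg of_nat_0_le_iff zero_le_power powr_ge_zero)
  next
    case False
    have "(e / 2 * real N) * (real N / 2) \<le> ((1 + e) * real j) * real (N - j)"
    proof (rule mult_mono)
      show "e / 2 * real N \<le> (1 + e) * real j" using False by linarith
      show "real N / 2 \<le> real (N - j)" using assms by (simp add: Nj)
    qed (use e in auto)
    then have "m \<ge> e / 4 * real N" using N by (simp add: m_def field_simps)
    then have "- m * ?l \<le> - (e / 4 * real N) * ?l" using l by (intro mult_right_mono) auto
    then have "exp (- m * ?l) \<le> (real N powr (- e / 4)) ^ N"
      unfolding powr_pow by (simp add: algebra_simps)
    then have "real (N choose j) * \<rho> ^ (j * (N - j)) \<le> real (N choose j) * (real N powr (- e / 4)) ^ N"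
      using bound by (intro mult_left_mono) auto
    then show ?thesis by (smt (verit) zero_le_power powr_ge_zero)
  qed
qed

text \<open>The first summand bounds two geometric series, one for small \<open>k\<close> and one for small \<open>N - k\<close>; the
  second comes from the middle range through \<open>\<Sum>k. N choose k = 2 ^ N\<close>.\<close>
lemma binomial_sum_le:
  fixes \<rho> e :: real
  assumes N: "N \<ge> 2" and e: "e > 0" and \<rho>0: "0 \<le> \<rho>"
    and \<rho>: "\<rho> \<le> exp (- (1 + e) * ln (real N) / real N)"
  defines "x \<equiv> real N powr (- e / 2)" and "y \<equiv> real N powr (- e / 4)"
  shows "(\<Sum>k=1..<N. real (N choose k) * \<rho> ^ (k * (N - k))) \<le> 2 * (x / (1 - x)) + (2 * y) ^ N"
proof -
  have x: "0 < x" "x < 1" using N e by (auto simp: x_def powr_less_one)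
  have y: "0 \<le> y" by (simp add: y_def)
  have term_le: "real (N choose k) * \<rho> ^ (k * (N - k)) \<le> x ^ k + x ^ (N - k) + real (N choose k) * y ^ N"
    if "k \<in> {1..<N}" for k
  proof (cases "2 * k \<le> N")
    case True
    have "real (N choose k) * \<rho> ^ (k * (N - k)) \<le> x ^ k + real (N choose k) * y ^ N"
      unfolding x_def y_def using that True e \<rho>0 \<rho> by (intro binomial_term_le_half) auto
    then show ?thesis using x by (smt (verit) zero_le_power)
  next
    case False
    have "real (N choose (N - k)) * \<rho> ^ ((N - k) * (N - (N - k)))
        \<le> x ^ (N - k) + real (N choose (N - k)) * y ^ N"
      unfolding x_def y_def using that False e \<rho>0 \<rho> by (intro binomial_term_le_half) auto
    moreover have "N choose (N - k) = N choose k" "N - (N - k) = k"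
      using that binomial_symmetric[of k N] by auto
    ultimately have "real (N choose k) * \<rho> ^ (k * (N - k)) \<le> x ^ (N - k) + real (N choose k) * y ^ N"
      by (simp add: mult.commute)
    then show ?thesis using x by (smt (verit) zero_le_power)
  qed
  have geo: "(\<Sum>k=1..<N. x ^ k) \<le> x / (1 - x)"
  proof -
    have "(\<Sum>k=1..<N. x ^ k) = (\<Sum>k<N - 1. x * x ^ k)"
      by (rule sum.reindex_bij_witness[of _ Suc "\<lambda>k. k - 1"]) (auto simp flip: power_Suc)
    also have "\<dots> = x * (\<Sum>k<N - 1. x ^ k)" by (simp add: sum_distrib_left)
    also have "\<dots> \<le> x * (1 / (1 - x))"
    proof (rule mult_left_mono)
      have "(\<Sum>k<N - 1. x ^ k) = (1 - x ^ (N - 1)) / (1 - x)" using x by (simp add: sum_gp_strict)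
      also have "\<dots> \<le> 1 / (1 - x)" using x by (intro divide_right_mono) auto
      finally show "(\<Sum>k<N - 1. x ^ k) \<le> 1 / (1 - x)" .
    qed (use x in simp)
    finally show ?thesis by simp
  qed
  have rev: "(\<Sum>k=1..<N. x ^ (N - k)) = (\<Sum>k=1..<N. x ^ k)"
    by (rule sum.reindex_bij_witness[of _ "\<lambda>k. N - k" "\<lambda>k. N - k"]) (use N in auto)
  have binom: "(\<Sum>k=1..<N. real (N choose k)) \<le> 2 ^ N"
  proof -
    have "(\<Sum>k=1..<N. real (N choose k)) \<le> (\<Sum>k\<le>N. real (N choose k))" by (intro sum_mono2) auto
    also have "\<dots> = 2 ^ N" using choose_row_sum[of N] by (simp flip: of_nat_sum)
    finally show ?thesis .
  qed
  have "(\<Sum>k=1..<N. real (N choose k) * \<rho> ^ (k * (N - k)))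
      \<le> (\<Sum>k=1..<N. x ^ k + x ^ (N - k) + real (N choose k) * y ^ N)"
    using term_le by (rule sum_mono)
  also have "\<dots> = 2 * (\<Sum>k=1..<N. x ^ k) + (\<Sum>k=1..<N. real (N choose k)) * y ^ N"
    by (simp add: sum.distrib rev sum_distrib_right del: One_nat_def)
  also have "\<dots> \<le> 2 * (x / (1 - x)) + 2 ^ N * y ^ N"
    using geo binom y by (intro add_mono mult_left_mono mult_right_mono) auto
  finally show ?thesis by (simp add: power_mult_distrib)
qed

lemma posterior_error_nonneg:
  assumes "\<And>t. t \<in> {1..T} \<Longrightarrow> p t \<in> {0..1}" and "\<And>t. t \<in> {1..T} \<Longrightarrow> q t \<in> {0..1}"
  shows "0 \<le> posterior_error N T p q prior z r"
  unfolding posterior_error_def posterior_def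
  by (intro sum_nonneg mult_nonneg_nonneg divide_nonneg_nonneg likelihood_nonneg assms pmf_nonneg)

theorem theorem2:
  fixes N T :: "nat \<Rightarrow> nat"
    and p q :: "nat \<Rightarrow> nat \<Rightarrow> real"
    and z :: "nat \<Rightarrow> nat \<Rightarrow> nat"
    and \<delta> :: real
  assumes "\<And>\<nu>. \<nu> \<ge> 1 \<Longrightarrow> N \<nu> \<ge> 1"
    and "\<And>\<nu>. \<nu> \<ge> 1 \<Longrightarrow> T \<nu> \<ge> 1"
    and "filterlim N at_top at_top"
    and "\<And>\<nu> t. \<nu> \<ge> 1 \<Longrightarrow> t \<in> {1..T \<nu>} \<Longrightarrow> p \<nu> t \<in> {0..1}"
    and "\<And>\<nu> t. \<nu> \<ge> 1 \<Longrightarrow> t \<in> {1..T \<nu>} \<Longrightarrow> q \<nu> t \<in> {0..1}"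
    and "\<delta> > 0"
    and "\<And>\<nu>. \<nu> \<ge> 1 \<Longrightarrow>
           (\<Sum>t=1..T \<nu>. renyi_half (p \<nu> t) (q \<nu> t)) \<ge>
             ereal ((2 + \<delta>) * (ln (real (N \<nu>)) / real (N \<nu>)))"
    and "\<And>\<nu>. \<nu> \<ge> 1 \<Longrightarrow> z \<nu> \<in> block_structures (N \<nu>)"
  shows "(\<lambda>\<nu>. posterior_error (N \<nu>) (T \<nu>) (p \<nu>) (q \<nu>)
            (pmf_of_set (block_structures (N \<nu>))) (z \<nu>) 0) \<in> o(\<lambda>_. 1)"
proof -
  define e where "e = \<delta> / 2"
  have e: "e > 0" using assms(6) by (simp add: e_def)
  define err where "err \<nu> = posterior_error (N \<nu>) (T \<nu>) (p \<nu>) (q \<nu>)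
            (pmf_of_set (block_structures (N \<nu>))) (z \<nu>) 0" for \<nu>
  define x where "x \<nu> = real (N \<nu>) powr (- e / 2)" for \<nu>
  define y where "y \<nu> = real (N \<nu>) powr (- e / 4)" for \<nu>
  have N_real: "filterlim (\<lambda>\<nu>. real (N \<nu>)) at_top sequentially"
    using filterlim_compose[OF filterlim_real_sequentially assms(3)] .
  have x0: "x \<longlonglongrightarrow> 0" unfolding x_def by (rule tendsto_neg_powr[OF _ N_real]) (use e in auto)
  have y0: "y \<longlonglongrightarrow> 0" unfolding y_def by (rule tendsto_neg_powr[OF _ N_real]) (use e in auto)
  have upper: "\<forall>\<^sub>F \<nu> in sequentially. err \<nu> \<le> 2 * (x \<nu> / (1 - x \<nu>)) + 2 * y \<nu>"
  proof -
    have "\<forall>\<^sub>F \<nu> in sequentially. y \<nu> < 1 / 2" using y0 by (rule order_tendstoD) simp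
    moreover have "\<forall>\<^sub>F \<nu> in sequentially. N \<nu> \<ge> 2"
      using assms(3) by (simp add: filterlim_at_top)
    ultimately show ?thesis using eventually_ge_at_top[of 1]
    proof eventually_elim
      case (elim \<nu>)
      let ?\<rho> = "\<Prod>t=1..T \<nu>. affinity (p \<nu> t) (q \<nu> t)"
      note p = assms(4)[OF elim(3)] and q = assms(5)[OF elim(3)]
      have "?\<rho> \<le> exp (- ((2 + \<delta>) * (ln (real (N \<nu>)) / real (N \<nu>))) / 2)"
        using prod_affinity_le_exp[OF p q assms(7)[OF elim(3)]] .
      also have "\<dots> = exp (- (1 + e) * ln (real (N \<nu>)) / real (N \<nu>))"
        by (simp add: e_def field_simps)
      finally have \<rho>: "?\<rho> \<le> \<dots>" .
      have \<rho>0: "0 \<le> ?\<rho>" by (intro prod_nonneg affinity_nonneg p q)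
      have "err \<nu> \<le> (\<Sum>k=1..<N \<nu>. real (N \<nu> choose k) * ?\<rho> ^ (k * (N \<nu> - k)))"
        unfolding err_def by (rule posterior_error_le_binomial_sum[OF p q assms(8)[OF elim(3)]])
      also have "\<dots> \<le> 2 * (x \<nu> / (1 - x \<nu>)) + (2 * y \<nu>) ^ N \<nu>"
        unfolding x_def y_def by (rule binomial_sum_le[OF elim(2) e \<rho>0 \<rho>])
      \<comment> \<open>Since \<open>2 y \<nu> < 1\<close>, its \<open>N \<nu>\<close>-th power is at most \<open>2 y \<nu>\<close>, which already tends to 0.\<close>
      also have "(2 * y \<nu>) ^ N \<nu> \<le> (2 * y \<nu>) ^ 1"
        using elim by (intro power_decreasing) (auto simp: y_def)
      finally show ?case by simp
    qed
  qed
  have "(\<lambda>\<nu>. 2 * (x \<nu> / (1 - x \<nu>)) + 2 * y \<nu>) \<longlonglongrightarrow> 2 * (0 / (1 - 0)) + 2 * 0"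
    by (intro tendsto_intros x0 y0) simp
  then have lim: "(\<lambda>\<nu>. 2 * (x \<nu> / (1 - x \<nu>)) + 2 * y \<nu>) \<longlonglongrightarrow> 0" by simp
  have lower: "\<forall>\<^sub>F \<nu> in sequentially. 0 \<le> err \<nu>"
    using eventually_ge_at_top[of 1]
    by eventually_elim (auto simp: err_def intro!: posterior_error_nonneg assms(4,5))
  have "err \<longlonglongrightarrow> 0" by (rule tendsto_sandwich[OF lower upper tendsto_const lim])
  then show ?thesis unfolding err_def by (intro smalloI_tendsto) auto
qed

end
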